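(* Let $(D,\mathscr{C})$ be a constrained polydifferential operator of rank $r$ and homogeneity $-2k$ on $n$-manifolds. Given a Riemannian $n$-manifold $(M,g)$, set $$U_{\mathscr{C}}^g := \left\{ u\in C^\infty(M) : C^g\bigl(u^{\otimes(r(C)-1)}\bigr)>0 \text{ for all } C\in\mathscr{C} \right\}.$$ The sets $U_{\mathscr{C}}^g$ have the following properties: (i) if $u\in U_{\mathscr{C}}^g$ and $c>0$ is a constant, then $cu\in U_{\mathscr{C}}^g$; (ii) if $\hat g=e^{2\Upsilon}g$ with $\Upsilon\in C^\infty(M)$, then $U_{\mathscr{C}}^{\hat g}=e^{-\frac{n-2k}{r}\Upsilon}U_{\mathscr{C}}^g$; (iii) if $f:\widehat M\to M$ is a local diffeomorphism, then $f^\ast(U_{\mathscr{C}}^g)\subseteq U_{\mathscr{C}}^{f^\ast g}$.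
   Context: All tensor products are over $\mathbb{R}$. A (natural) polydifferential operator of rank $\ell+1$ ($\ell \ge 0$) on $n$-manifolds is an assignment $D$ to each Riemannian $n$-manifold $(M,g)$ of a linear operator $D^g : C^\infty(M)^{\otimes \ell} \to C^\infty(M)$ such that $D^g(u_1\otimes\cdots\otimes u_\ell)$ is expressed by a universal (coefficients independent of $(M,g)$) $\mathbb{R}$-linear combination of complete contractions, formed with $g$, of tensors $\nabla^{N_1}\mathrm{Rm}\otimes\cdots\otimes\nabla^{N_p}\mathrm{Rm}\otimes\nabla^{N_{p+1}}u_1\otimes\cdots\otimes\nabla^{N_{p+\ell}}u_\ell$, where $\mathrm{Rm}$ is the Riemann curvature tensor. It is symmetric if $D^g(u_1\otimes\cdots\otimes u_\ell)$ is invariant under permutations of the $u_j$, and conformally covariant if there are $a_1,\dots,a_\ell,b\in\mathbb{R}$ with $D^{e^{2\Upsilon}g}(u_1\otimes\cdots\otimes u_\ell)=e^{b\Upsilon}D^g(e^{-a_1\Upsilon}u_1\otimes\cdots\otimes e^{-a_\ell\Upsilon}u_\ell)$ always. $D$ has homogeneity $h$ if $D^{c^2g}=c^{h}D^g$ for all $(M,g)$ and all constants $c>0$. A formally self-adjoint, conformally covariant, polydifferential operator of rank $r\ge 1$ and homogeneity $-2k$ on $n$-manifolds is a natural polydifferential operator $D$ of rank $r$ and homogeneity $-2k$ such that (1) the Dirichlet form $\mathfrak{D}^g(u_1\otimes\cdots\otimes u_r) := \int_M u_1 D^g(u_2\otimes\cdots\otimes u_r)\,dV_g$ on $C_0^\infty(M)^{\otimes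 r}$ is invariant under permutations of $u_1,\dots,u_r$; and (2) with $w=-\frac{n-2k}{r}$, if $\hat g=e^{2\Upsilon}g$ then $\mathfrak{D}^{\hat g}(e^{w\Upsilon}u_1\otimes\cdots\otimes e^{w\Upsilon}u_r)=\mathfrak{D}^g(u_1\otimes\cdots\otimes u_r)$. A constrained polydifferential operator of rank $r$ and homogeneity $-2k$ on $n$-manifolds is a pair $(D,\mathscr{C})$ of such an operator $D$ and a (possibly empty) finite set $\mathscr{C}$ of symmetric conformally covariant polydifferential operators such that for each $C\in\mathscr{C}$, with $r(C)$ the rank of $C$, there is a $b(C)\in\mathbb{R}$ with $C^{e^{2\Upsilon}g}\bigl(u^{\otimes(r(C)-1)}\bigr)=e^{b(C)\Upsilon}C^g\bigl((e^{\frac{n-2k}{r}\Upsilon}u)^{\otimes(r(C)-1)}\bigr)$ for all Riemannian $n$-manifolds $(M,g)$ and all $\Upsilon,u\in C^\infty(M)$. *)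

theory Defs
  imports "HOL-Analysis.Analysis" "HOL-Library.Multiset"
begin

section \<open>Smooth functions on open subsets of Euclidean space\<close>

definition partial :: "'n::finite \<Rightarrow> (real^'n \<Rightarrow> 'b::real_normed_vector) \<Rightarrow> real^'n \<Rightarrow> 'b" where
  "partial i f x = frechet_derivative f (at x) (axis i 1)"

text \<open>All iterated partial derivatives exist and are (totally) differentiable.  Only used for
  open \<open>S\<close>, where this is the usual notion of a function of class \<open>C\<^sup>\<infinity>\<close>.\<close>

definition smooth_on :: "(real^'n::finite) set \<Rightarrow> (real^'n \<Rightarrow> 'b::real_normed_vector) \<Rightarrow> bool" where
  "smooth_on S f \<longleftrightarrow> (\<forall>is. \<forall>x\<in>S. (foldr partial is f) differentiable (at x))"


section \<open>Smooth manifolds\<close>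

text \<open>The points of a manifold form a subset (the topspace) of a type \<open>'a\<close>; the dimension is
  \<open>CARD('n)\<close>.  As a second countable manifold has at most continuum many points, every manifold
  is diffeomorphic to one over \<open>'a\<close> as soon as \<open>'a\<close> has at least the cardinality of \<open>real\<close>.
  A chart is a pair of an open set \<open>U\<close> and a map whose values outside \<open>U\<close> are irrelevant;
  since the atlas is maximal, it contains all such extensions of each of its charts.\<close>

type_synonym ('a, 'n) chart = "'a set \<times> ('a \<Rightarrow> real^'n)"

record ('a, 'n::finite) mfd =
  mtop :: "'a topology"
  atlas :: "('a, 'n) chart set"

abbreviation pts :: "('a, 'n::finite, 'z) mfd_scheme \<Rightarrow> 'a set" where
  "pts M \<equiv> topspace (mtop M)"

definition is_chart :: "'a topology \<Rightarrow> ('a, 'n::finite) chart \<Rightarrow> bool" where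
  "is_chart X = (\<lambda>(U, \<phi>). openin X U \<and> open (\<phi> ` U) \<and>
     homeomorphic_map (subtopology X U) (top_of_set (\<phi> ` U)) \<phi>)"

definition compatible :: "('a, 'n::finite) chart \<Rightarrow> ('a, 'n) chart \<Rightarrow> bool" where
  "compatible = (\<lambda>(U, \<phi>) (V, \<psi>).
     smooth_on (\<phi> ` (U \<inter> V)) (\<psi> \<circ> inv_into U \<phi>) \<and>
     smooth_on (\<psi> ` (U \<inter> V)) (\<phi> \<circ> inv_into V \<psi>))"

definition smooth_manifold :: "('a, 'n::finite, 'z) mfd_scheme \<Rightarrow> bool" where
  "smooth_manifold M \<longleftrightarrow>
     Hausdorff_space (mtop M) \<and> second_countable (mtop M) \<and>
     (\<Union>(U, \<phi>)\<in>atlas M. U) = pts M \<and>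
     (\<forall>c\<in>atlas M. is_chart (mtop M) c) \<and>
     (\<forall>c\<in>atlas M. \<forall>d\<in>atlas M. compatible c d) \<and>
     (\<forall>c. is_chart (mtop M) c \<and> (\<forall>d\<in>atlas M. compatible c d) \<longrightarrow> c \<in> atlas M)"

definition smooth_fun_on :: "('a, 'n::finite, 'z) mfd_scheme \<Rightarrow> 'a set \<Rightarrow> ('a \<Rightarrow> real) \<Rightarrow> bool" where
  "smooth_fun_on M W h \<longleftrightarrow>
     (\<forall>(U, \<phi>)\<in>atlas M. smooth_on (\<phi> ` (U \<inter> W)) (h \<circ> inv_into U \<phi>))"

text \<open>A smooth function on \<open>M\<close> is represented by its extension by zero to the whole type, so that
  equality of elements of \<open>C_inf M\<close> is equality of functions on \<open>M\<close>.\<close>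

definition C_inf :: "('a, 'n::finite, 'z) mfd_scheme \<Rightarrow> ('a \<Rightarrow> real) set" where
  "C_inf M = {u. smooth_fun_on M (pts M) u \<and> (\<forall>p. p \<notin> pts M \<longrightarrow> u p = 0)}"

definition C_inf_cpt :: "('a, 'n::finite, 'z) mfd_scheme \<Rightarrow> ('a \<Rightarrow> real) set" where
  "C_inf_cpt M = {u \<in> C_inf M. compactin (mtop M) (mtop M closure_of {p \<in> pts M. u p \<noteq> 0})}"

definition local_diffeo ::
  "('a, 'n::finite, 'y) mfd_scheme \<Rightarrow> ('a, 'n, 'z) mfd_scheme \<Rightarrow> ('a \<Rightarrow> 'a) \<Rightarrow> bool" where
  "local_diffeo N M f \<longleftrightarrow> (\<forall>p\<in>pts N. \<exists>W. p \<in> W \<and> openin (mtop N) W \<and> openin (mtop M) (f ` W) \<and>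
     homeomorphic_map (subtopology (mtop N) W) (subtopology (mtop M) (f ` W)) f \<and>
     (\<forall>(U, \<phi>)\<in>atlas N. \<forall>(V, \<psi>)\<in>atlas M.
        smooth_on (\<phi> ` {q \<in> U \<inter> W. f q \<in> V}) (\<psi> \<circ> f \<circ> inv_into U \<phi>) \<and>
        smooth_on (\<psi> ` (V \<inter> f ` (U \<inter> W))) (\<phi> \<circ> inv_into W f \<circ> inv_into V \<psi>)))"

definition pullback ::
  "('a, 'n::finite, 'y) mfd_scheme \<Rightarrow> ('a \<Rightarrow> 'a) \<Rightarrow> ('a \<Rightarrow> real) \<Rightarrow> ('a \<Rightarrow> real)" where
  "pullback N f u = (\<lambda>p. if p \<in> pts N then u (f p) else 0)"


section \<open>Tangent vectors and Riemannian metrics\<close>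

definition smooth_near :: "('a, 'n::finite, 'z) mfd_scheme \<Rightarrow> 'a \<Rightarrow> ('a \<Rightarrow> real) \<Rightarrow> bool" where
  "smooth_near M p h \<longleftrightarrow> (\<exists>W. p \<in> W \<and> openin (mtop M) W \<and> smooth_fun_on M W h)"

text \<open>Tangent vectors at \<open>p\<close> are the derivations of the germs at \<open>p\<close> of smooth functions.  That \<open>v h\<close>
  depends only on the germ of \<open>h\<close> follows from the Leibniz rule, applied to \<open>h\<close> and to the
  indicator function of a set that is disjoint from a neighbourhood of \<open>p\<close>.\<close>

type_synonym 'a tvec = "('a \<Rightarrow> real) \<Rightarrow> real"

definition tangent :: "('a, 'n::finite, 'z) mfd_scheme \<Rightarrow> 'a \<Rightarrow> 'a tvec set" where
  "tangent M p = {v.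
     (\<forall>h k. smooth_near M p h \<and> smooth_near M p k \<longrightarrow>
        v (\<lambda>q. h q + k q) = v h + v k \<and>
        v (\<lambda>q. h q * k q) = h p * v k + k p * v h) \<and>
     (\<forall>h a. smooth_near M p h \<longrightarrow> v (\<lambda>q. a * h q) = a * v h) \<and>
     (\<forall>h. \<not> smooth_near M p h \<longrightarrow> v h = 0)}"

definition coord_vec :: "('a, 'n::finite, 'z) mfd_scheme \<Rightarrow> ('a, 'n) chart \<Rightarrow> 'a \<Rightarrow> 'n \<Rightarrow> 'a tvec" where
  "coord_vec M = (\<lambda>(U, \<phi>) p i h.
     if smooth_near M p h then partial i (h \<circ> inv_into U \<phi>) (\<phi> p) else 0)"

definition pushforward ::
  "('a, 'n::finite, 'z) mfd_scheme \<Rightarrow> ('a \<Rightarrow> 'a) \<Rightarrow> 'a \<Rightarrow> 'a tvec \<Rightarrow> 'a tvec" where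
  "pushforward M f p v = (\<lambda>h. if smooth_near M (f p) h then v (h \<circ> f) else 0)"

record ('a, 'n::finite) riem = "('a, 'n) mfd" +
  metric :: "'a \<Rightarrow> 'a tvec \<Rightarrow> 'a tvec \<Rightarrow> real"

definition gmat :: "('a, 'n::finite) riem \<Rightarrow> ('a, 'n) chart \<Rightarrow> real^'n \<Rightarrow> real^'n^'n" where
  "gmat M c x = (let p = inv_into (fst c) (snd c) x in
     \<chi> i j. metric M p (coord_vec M c p i) (coord_vec M c p j))"

text \<open>The metric is an inner product on each tangent space whose components in every chart are
  smooth; it is set to zero on all other arguments, so that it is determined by its values on
  tangent vectors.\<close>

definition riemannian_manifold :: "('a, 'n::finite) riem \<Rightarrow> bool" where
  "riemannian_manifold M \<longleftrightarrow> smooth_manifold M \<and>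
     (\<forall>p\<in>pts M. \<forall>v\<in>tangent M p. \<forall>w\<in>tangent M p. metric M p v w = metric M p w v) \<and>
     (\<forall>p\<in>pts M. \<forall>v\<in>tangent M p. \<forall>v'\<in>tangent M p. \<forall>w\<in>tangent M p. \<forall>a b.
        metric M p (\<lambda>h. a * v h + b * v' h) w = a * metric M p v w + b * metric M p v' w) \<and>
     (\<forall>p\<in>pts M. \<forall>v\<in>tangent M p. v \<noteq> (\<lambda>h. 0) \<longrightarrow> metric M p v v > 0) \<and>
     (\<forall>p v w. \<not> (p \<in> pts M \<and> v \<in> tangent M p \<and> w \<in> tangent M p) \<longrightarrow> metric M p v w = 0) \<and>
     (\<forall>(U, \<phi>)\<in>atlas M. \<forall>i j. smooth_on (\<phi> ` U) (\<lambda>x. gmat M (U, \<phi>) x $ i $ j))"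

definition conformal :: "('a \<Rightarrow> real) \<Rightarrow> ('a, 'n::finite) riem \<Rightarrow> ('a, 'n) riem" where
  "conformal \<Upsilon> M = M\<lparr>metric := (\<lambda>p v w. exp (2 * \<Upsilon> p) * metric M p v w)\<rparr>"

definition rescale :: "real \<Rightarrow> ('a, 'n::finite) riem \<Rightarrow> ('a, 'n) riem" where
  "rescale a M = M\<lparr>metric := (\<lambda>p v w. a * metric M p v w)\<rparr>"

definition pullback_riem ::
  "('a, 'n::finite) mfd \<Rightarrow> ('a \<Rightarrow> 'a) \<Rightarrow> ('a, 'n) riem \<Rightarrow> ('a, 'n) riem" where
  "pullback_riem N f M = \<lparr>mtop = mtop N, atlas = atlas N,
     metric = (\<lambda>p v w. if p \<in> pts N \<and> v \<in> tangent N p \<and> w \<in> tangent N p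
                then metric M (f p) (pushforward M f p v) (pushforward M f p w) else 0)\<rparr>"

definition is_volume :: "('a, 'n::finite) riem \<Rightarrow> 'a measure \<Rightarrow> bool" where
  "is_volume M \<mu> \<longleftrightarrow> space \<mu> = pts M \<and> sets \<mu> = sigma_sets (pts M) {U. openin (mtop M) U} \<and>
     (\<forall>(U, \<phi>)\<in>atlas M. \<forall>B\<in>sets \<mu>. B \<subseteq> U \<longrightarrow>
        emeasure \<mu> B =
          (\<integral>\<^sup>+x. ennreal (sqrt (det (gmat M (U, \<phi>) x))) * indicator (\<phi> ` B) x \<partial>lborel))"

text \<open>The Riemannian measure exists, and by second countability it is unique.\<close>

definition vol :: "('a, 'n::finite) riem \<Rightarrow> 'a measure" where
  "vol M = (THE \<mu>. is_volume M \<mu>)"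


section \<open>Tensors in local coordinates\<close>

text \<open>In a chart, a covariant tensor of valence \<open>m\<close> is given by its components: for each list of \<open>m\<close>
  indices a function on the image of the chart.  The values on lists of other lengths are
  irrelevant.\<close>

type_synonym 'n tensor = "'n list \<Rightarrow> real^'n \<Rightarrow> real"

definition christoffel ::
  "('a, 'n::finite) riem \<Rightarrow> ('a, 'n) chart \<Rightarrow> 'n \<Rightarrow> 'n \<Rightarrow> 'n \<Rightarrow> real^'n \<Rightarrow> real" where
  "christoffel M c l i j x = (1/2) * (\<Sum>m\<in>UNIV. matrix_inv (gmat M c x) $ l $ m *
     (partial i (\<lambda>y. gmat M c y $ j $ m) x + partial j (\<lambda>y. gmat M c y $ i $ m) x
      - partial m (\<lambda>y. gmat M c y $ i $ j) x))"

text \<open>The components \<open>g (R (\<partial>\<^sub>i, \<partial>\<^sub>j) \<partial>\<^sub>k, \<partial>\<^sub>l)\<close>, where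
  \<open>R (X, Y) = [\<nabla>\<^sub>X, \<nabla>\<^sub>Y] - \<nabla>\<^bsub>[X, Y]\<^esub>\<close>.\<close>

definition riemann :: "('a, 'n::finite) riem \<Rightarrow> ('a, 'n) chart \<Rightarrow> 'n tensor" where
  "riemann M c is x = (let i = is ! 0; j = is ! 1; k = is ! 2; l = is ! 3; \<Gamma> = christoffel M c in
     (\<Sum>m\<in>UNIV. gmat M c x $ l $ m *
        (partial i (\<Gamma> m j k) x - partial j (\<Gamma> m i k) x
         + (\<Sum>s\<in>UNIV. \<Gamma> m i s x * \<Gamma> s j k x - \<Gamma> m j s x * \<Gamma> s i k x))))"

text \<open>The Levi-Civita connection; the index of differentiation comes first.\<close>

fun nabla :: "('a, 'n::finite) riem \<Rightarrow> ('a, 'n) chart \<Rightarrow> 'n tensor \<Rightarrow> 'n tensor" where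
  "nabla M c T [] x = 0"
| "nabla M c T (k # is) x = partial k (T is) x
     - (\<Sum>s<length is. \<Sum>l\<in>UNIV. christoffel M c l k (is ! s) x * T (is[s := l]) x)"

text \<open>Tensor product, at one point, of tensors given with their valences.\<close>

fun tensor_prod :: "(nat \<times> ('n list \<Rightarrow> real)) list \<Rightarrow> 'n list \<Rightarrow> real" where
  "tensor_prod [] is = 1"
| "tensor_prod ((m, T) # Ts) is = T (take m is) * tensor_prod Ts (drop m is)"

text \<open>A complete contraction of a tensor of valence \<open>L\<close> is given by a partition of its \<open>L\<close> slots into
  pairs, that is, by a fixed point free involution \<open>\<sigma>\<close> of \<open>{..<L}\<close>.\<close>

definition pairing :: "nat \<Rightarrow> (nat \<Rightarrow> nat) \<Rightarrow> bool" where
  "pairing L \<sigma> \<longleftrightarrow> (\<forall>a<L. \<sigma> a < L \<and> \<sigma> a \<noteq> a \<and> \<sigma> (\<sigma> a) = a)"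

definition contraction ::
  "real^'n^'n \<Rightarrow> nat \<Rightarrow> (nat \<Rightarrow> nat) \<Rightarrow> ('n::finite list \<Rightarrow> real) \<Rightarrow> real" where
  "contraction G L \<sigma> T = (\<Sum>is | length is = L.
     (\<Prod>a | a < L \<and> a < \<sigma> a. matrix_inv G $ (is ! a) $ (is ! \<sigma> a)) * T is)"

text \<open>\<open>(a, Ps, Ns, \<sigma>)\<close> stands for \<open>a\<close> times the complete contraction \<open>\<sigma>\<close> of
  \<open>\<nabla>\<^bsup>N\<^esup> Rm\<close> for \<open>N\<close> in \<open>Ps\<close>, tensored with \<open>\<nabla>\<^bsup>N\<^esup> u\<close> for \<open>N\<close> in \<open>Ns\<close> and
  the corresponding argument \<open>u\<close>.\<close>

type_synonym contraction_term = "real \<times> nat list \<times> nat list \<times> (nat \<Rightarrow> nat)"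

definition slots :: "nat list \<Rightarrow> nat list \<Rightarrow> nat" where
  "slots Ps Ns = sum_list (map (\<lambda>N. N + 4) Ps) + sum_list Ns"

definition wf_term :: "nat \<Rightarrow> contraction_term \<Rightarrow> bool" where
  "wf_term l = (\<lambda>(a, Ps, Ns, \<sigma>). length Ns = l \<and> pairing (slots Ps Ns) \<sigma>)"

definition eval_term ::
  "('a, 'n::finite) riem \<Rightarrow> ('a, 'n) chart \<Rightarrow> ('a \<Rightarrow> real) list \<Rightarrow> real^'n \<Rightarrow> contraction_term \<Rightarrow> real"
where
  "eval_term M c us x = (\<lambda>(a, Ps, Ns, \<sigma>). a * contraction (gmat M c x) (slots Ps Ns) \<sigma>
     (tensor_prod
       (map (\<lambda>N. (N + 4, \<lambda>is. (nabla M c ^^ N) (riemann M c) is x)) Ps @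
        map2 (\<lambda>N u. (N, \<lambda>is. (nabla M c ^^ N) (\<lambda>_. u \<circ> inv_into (fst c) (snd c)) is x)) Ns us)))"


section \<open>Polydifferential operators\<close>

text \<open>A linear map on the \<open>l\<close>-fold tensor power of \<open>C\<^sup>\<infinity>(M)\<close> is represented by the corresponding
  \<open>l\<close>-linear map, acting on lists of length \<open>l = rank - 1\<close>.\<close>

record ('a, 'n::finite) polydiff =
  rank :: nat
  opr :: "('a, 'n) riem \<Rightarrow> ('a \<Rightarrow> real) list \<Rightarrow> 'a \<Rightarrow> real"

definition tuples :: "'b set \<Rightarrow> nat \<Rightarrow> 'b list set" where
  "tuples A l = {us. set us \<subseteq> A \<and> length us = l}"

definition multilinear ::
  "('a, 'n::finite) riem \<Rightarrow> nat \<Rightarrow> (('a \<Rightarrow> real) list \<Rightarrow> 'a \<Rightarrow> real) \<Rightarrow> bool" where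
  "multilinear M l F \<longleftrightarrow> (\<forall>us\<in>tuples (C_inf M) l. F us \<in> C_inf M \<and>
     (\<forall>i<l. \<forall>v\<in>C_inf M. \<forall>a b.
        F (us[i := (\<lambda>p. a * (us ! i) p + b * v p)]) = (\<lambda>p. a * F us p + b * F (us[i := v]) p)))"

text \<open>A complete contraction does not depend on the chart in which it is computed, so the natural
  formula is required to hold in every chart.  The list \<open>ts\<close> of terms is the same for all \<open>M\<close>.\<close>

definition polydiff_op :: "('a, 'n::finite) polydiff \<Rightarrow> bool" where
  "polydiff_op D \<longleftrightarrow> rank D \<ge> 1 \<and>
     (\<forall>M. riemannian_manifold M \<longrightarrow> multilinear M (rank D - 1) (opr D M)) \<and>
     (\<exists>ts. list_all (wf_term (rank D - 1)) ts \<and>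
        (\<forall>M. riemannian_manifold M \<longrightarrow>
          (\<forall>us\<in>tuples (C_inf M) (rank D - 1). \<forall>(U, \<phi>)\<in>atlas M. \<forall>p\<in>U.
             opr D M us p = sum_list (map (eval_term M (U, \<phi>) us (\<phi> p)) ts))))"

definition symmetric_op :: "('a, 'n::finite) polydiff \<Rightarrow> bool" where
  "symmetric_op D \<longleftrightarrow> (\<forall>M. riemannian_manifold M \<longrightarrow>
     (\<forall>us\<in>tuples (C_inf M) (rank D - 1). \<forall>vs. mset vs = mset us \<longrightarrow> opr D M vs = opr D M us))"

definition exp_mult :: "real \<Rightarrow> ('a \<Rightarrow> real) \<Rightarrow> ('a \<Rightarrow> real) \<Rightarrow> 'a \<Rightarrow> real" where
  "exp_mult a \<Upsilon> u = (\<lambda>p. exp (a * \<Upsilon> p) * u p)"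

definition conformally_covariant :: "('a, 'n::finite) polydiff \<Rightarrow> bool" where
  "conformally_covariant D \<longleftrightarrow> (\<exists>as b. length as = rank D - 1 \<and>
     (\<forall>M. riemannian_manifold M \<longrightarrow>
       (\<forall>\<Upsilon>\<in>C_inf M. \<forall>us\<in>tuples (C_inf M) (rank D - 1).
          opr D (conformal \<Upsilon> M) us =
            exp_mult b \<Upsilon> (opr D M (map2 (\<lambda>a u. exp_mult (- a) \<Upsilon> u) as us)))))"

definition homogeneous :: "('a, 'n::finite) polydiff \<Rightarrow> real \<Rightarrow> bool" where
  "homogeneous D h \<longleftrightarrow> (\<forall>M c. riemannian_manifold M \<and> c > 0 \<longrightarrow>
     (\<forall>us\<in>tuples (C_inf M) (rank D - 1).
        opr D (rescale (c\<^sup>2) M) us = (\<lambda>p. c powr h * opr D M us p)))"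

definition dirichlet :: "('a, 'n::finite) polydiff \<Rightarrow> ('a, 'n) riem \<Rightarrow> ('a \<Rightarrow> real) list \<Rightarrow> real" where
  "dirichlet D M us = (LINT p|vol M. hd us p * opr D M (tl us) p)"

definition selfadjoint_covariant_op ::
  "('a, 'n::finite) polydiff \<Rightarrow> nat \<Rightarrow> real \<Rightarrow> bool" where
  "selfadjoint_covariant_op D r k \<longleftrightarrow>
     r \<ge> 1 \<and> polydiff_op D \<and> rank D = r \<and> homogeneous D (- 2 * k) \<and>
     (\<forall>M. riemannian_manifold M \<longrightarrow>
       (\<forall>us\<in>tuples (C_inf_cpt M) r. \<forall>vs. mset vs = mset us \<longrightarrow>
          dirichlet D M vs = dirichlet D M us)) \<and>
     (\<forall>M. riemannian_manifold M \<longrightarrow>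
       (\<forall>\<Upsilon>\<in>C_inf M. \<forall>us\<in>tuples (C_inf_cpt M) r.
          dirichlet D (conformal \<Upsilon> M)
            (map (exp_mult (- ((real CARD('n) - 2 * k) / real r)) \<Upsilon>) us) = dirichlet D M us))"

definition constrained_op ::
  "('a, 'n::finite) polydiff \<times> ('a, 'n) polydiff set \<Rightarrow> nat \<Rightarrow> real \<Rightarrow> bool" where
  "constrained_op = (\<lambda>(D, \<C>) r k.
     selfadjoint_covariant_op D r k \<and> finite \<C> \<and>
     (\<forall>C\<in>\<C>. polydiff_op C \<and> symmetric_op C \<and> conformally_covariant C \<and>
       (\<exists>b. \<forall>M. riemannian_manifold M \<longrightarrow> (\<forall>\<Upsilon>\<in>C_inf M. \<forall>u\<in>C_inf M.
          opr C (conformal \<Upsilon> M) (replicate (rank C - 1) u) =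
            exp_mult b \<Upsilon> (opr C M (replicate (rank C - 1)
              (exp_mult ((real CARD('n) - 2 * k) / real r) \<Upsilon> u)))))))"

definition U_set :: "('a, 'n::finite) polydiff set \<Rightarrow> ('a, 'n) riem \<Rightarrow> ('a \<Rightarrow> real) set" where
  "U_set \<C> M = {u \<in> C_inf M. \<forall>C\<in>\<C>. \<forall>p\<in>pts M. opr C M (replicate (rank C - 1) u) p > 0}"

end

theory Submission
  imports Defs
begin

text \<open>Parts (i) and (ii) follow from multilinearity and from the conformal covariance of each
  constraint, as \<open>C\<^sup>\<infinity>(M)\<close> is closed under multiplication by constants and by \<open>e\<^bsup>a\<Upsilon>\<^esup>\<close>.
  Part (iii) is the naturality of operators given by universal formulas in the metric and its
  derivatives: in corresponding charts of the two manifolds, these formulas see the same metric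
  components and the same functions.\<close>

section \<open>Smooth functions on open sets\<close>

text \<open>Part (iii) carries the weight. The universal formula for \<open>opr C\<close> is
  available only on Riemannian manifolds and only in charts of the atlas, so the pullback has to be
  shown Riemannian and each chart of \<open>N\<close> needs a partner on \<open>M\<close>. As
  \<open>f\<close> need not be injective, one works on an open \<open>W\<close> that
  \<open>f\<close> maps diffeomorphically onto an open set, with inverse \<open>g\<close>. The
  partner of \<open>\<phi>\<close> is \<open>\<phi> \<circ> g\<close>, which belongs to the atlas of
  \<open>M\<close> because that atlas is maximal. The two charts have the same image, and in them
  \<open>f\<close> is the identity of \<open>real^'n\<close>. Smoothness, tangent vectors and metric
  components are therefore compared by agreement on an open set, and no chain rule for
  \<open>f\<close> is invoked.\<close>

lemma partial_cong:
  assumes "open S" "x \<in> S" "\<And>y. y \<in> S \<Longrightarrow> f y = g y"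
  shows "partial i f x = partial i g x"
proof -
  \<comment> \<open>\<open>frechet_derivative\<close> chooses some derivative, so it suffices that
    \<open>f\<close> and \<open>g\<close> have the same derivatives at \<open>x\<close>; this covers
    points where there is none.\<close>
  have "(f has_derivative D) (at x) \<longleftrightarrow> (g has_derivative D) (at x)" for D
    using assms has_derivative_transform_within_open[of f D x UNIV S g]
      has_derivative_transform_within_open[of g D x UNIV S f] by auto
  then show ?thesis
    by (simp add: partial_def frechet_derivative_def)
qed

lemma foldr_partial_cong:
  assumes "open S" "x \<in> S" "\<And>y. y \<in> S \<Longrightarrow> f y = g y"
  shows "foldr partial is f x = foldr partial is g x"
  using assms(2) by (induction "is" arbitrary: x) (auto intro: partial_cong assms)

lemma differentiable_cong_open:
  assumes "open S" "x \<in> S" "\<And>y. y \<in> S \<Longrightarrow> f y = g y" "f differentiable (at x)"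
  shows "g differentiable (at x)"
  using assms has_derivative_transform_within_open[of f _ x UNIV S g]
  unfolding differentiable_def by blast

lemma smooth_on_cong:
  assumes "open S" "\<And>y. y \<in> S \<Longrightarrow> f y = g y" "smooth_on S f"
  shows "smooth_on S g"
  unfolding smooth_on_def
proof (intro allI ballI)
  fix "is" x assume "x \<in> S"
  moreover have "foldr partial is f y = foldr partial is g y" if "y \<in> S" for y
    using foldr_partial_cong[OF assms(1) that assms(2)] .
  moreover have "foldr partial is f differentiable (at x)"
    using assms(3) \<open>x \<in> S\<close> unfolding smooth_on_def by blast
  ultimately show "foldr partial is g differentiable (at x)"
    by (rule differentiable_cong_open[OF assms(1)])
qed

lemma smooth_on_subset: "smooth_on S f \<Longrightarrow> T \<subseteq> S \<Longrightarrow> smooth_on T f"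
  unfolding smooth_on_def by blast

text \<open>\<open>smooth_on\<close> imposes a condition at each point separately, so a different
  \<open>T\<close> may serve each point. This is how local inverses of \<open>f\<close> yield global
  smoothness.\<close>

lemma smooth_on_local:
  assumes "\<And>x. x \<in> S \<Longrightarrow> \<exists>T. x \<in> T \<and> smooth_on T f"
  shows "smooth_on S f"
  using assms unfolding smooth_on_def by blast

text \<open>Smoothness graded by the number of derivatives. The product and exponential rules
  produce new sums and products, so they need an induction on the order that is general in the
  function; \<open>smooth_on\<close> by itself offers none.\<close>

fun times_diff :: "nat \<Rightarrow> (real^'n::finite) set \<Rightarrow> (real^'n \<Rightarrow> 'b::real_normed_vector) \<Rightarrow> bool" where
  "times_diff 0 S f = (\<forall>x\<in>S. f differentiable (at x))"
| "times_diff (Suc n) S f =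
    ((\<forall>x\<in>S. f differentiable (at x)) \<and> (\<forall>i. times_diff n S (partial i f)))"

lemma times_diff_iff:
  "times_diff n S f \<longleftrightarrow>
    (\<forall>is. length is \<le> n \<longrightarrow> (\<forall>x\<in>S. foldr partial is f differentiable (at x)))"
proof (induction n arbitrary: f)
  case (Suc n)
  show ?case
  proof
    assume *: "times_diff (Suc n) S f"
    show "\<forall>is. length is \<le> Suc n \<longrightarrow> (\<forall>x\<in>S. foldr partial is f differentiable (at x))"
    proof (intro allI impI)
      fix "is" :: "'a list" assume "length is \<le> Suc n"
      then show "\<forall>x\<in>S. foldr partial is f differentiable (at x)"
        \<comment> \<open>\<open>foldr\<close> applies the last index first, and that innermost
          derivative is the one \<open>times_diff\<close> splits off.\<close>
        using * Suc by (cases "is" rule: rev_cases) auto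
    qed
  next
    assume *: "\<forall>is. length is \<le> Suc n \<longrightarrow> (\<forall>x\<in>S. foldr partial is f differentiable (at x))"
    have "foldr partial is (partial i f) differentiable (at x)"
      if "length is \<le> n" "x \<in> S" for "is" i x
      using *[rule_format, of "is @ [i]" x] that by simp
    moreover have "f differentiable (at x)" if "x \<in> S" for x
      using *[rule_format, of "[]" x] that by simp
    ultimately show "times_diff (Suc n) S f"
      using Suc by auto
  qed
qed simp

lemma smooth_on_iff_times_diff: "smooth_on S f \<longleftrightarrow> (\<forall>n. times_diff n S f)"
  unfolding smooth_on_def times_diff_iff by blast

lemma times_diff_lower: "times_diff (Suc n) S f \<Longrightarrow> times_diff n S f"
  unfolding times_diff_iff by auto

lemma times_diff_cong:
  assumes "open S" "\<And>y. y \<in> S \<Longrightarrow> f y = g y" "times_diff n S f"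
  shows "times_diff n S g"
  using assms(2,3)
proof (induction n arbitrary: f g)
  case 0
  then show ?case
    using differentiable_cong_open[OF assms(1), of _ f g] by simp
next
  case (Suc n)
  have "times_diff n S (partial i g)" for i
    using Suc.IH[of "partial i f" "partial i g"] partial_cong[OF assms(1), of _ f g] Suc.prems by simp
  then show ?case
    using differentiable_cong_open[OF assms(1), of _ f g] Suc.prems by simp
qed

section \<open>Sums, products and exponentials of smooth functions\<close>

lemma partial_add:
  assumes "f differentiable (at x)" "g differentiable (at x)"
  shows "partial i (\<lambda>x. f x + g x) x = partial i f x + partial i g x"
proof -
  have "((\<lambda>x. f x + g x) has_derivative
      (\<lambda>h. frechet_derivative f (at x) h + frechet_derivative g (at x) h)) (at x)"
    using assms by (intro has_derivative_add) (simp_all add: frechet_derivative_works)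
  from frechet_derivative_at[OF this] show ?thesis
    by (simp add: partial_def fun_eq_iff)
qed

lemma partial_mult:
  fixes f g :: "real^'n::finite \<Rightarrow> real"
  assumes "f differentiable (at x)" "g differentiable (at x)"
  shows "partial i (\<lambda>x. f x * g x) x = f x * partial i g x + partial i f x * g x"
proof -
  have "((\<lambda>x. f x * g x) has_derivative
      (\<lambda>h. f x * frechet_derivative g (at x) h + frechet_derivative f (at x) h * g x)) (at x)"
    using assms by (intro has_derivative_mult) (simp_all add: frechet_derivative_works)
  from frechet_derivative_at[OF this] show ?thesis
    by (simp add: partial_def fun_eq_iff)
qed

lemma partial_const: "partial i (\<lambda>x. c) = (\<lambda>x. 0)"
  by (simp add: partial_def fun_eq_iff)

lemma partial_cmult:
  fixes f :: "real^'n::finite \<Rightarrow> real"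
  assumes "f differentiable (at x)"
  shows "partial i (\<lambda>x. c * f x) x = c * partial i f x"
  using partial_mult[of "\<lambda>x. c" x f i] assms by (simp add: partial_const)

lemma partial_exp:
  fixes f :: "real^'n::finite \<Rightarrow> real"
  assumes "f differentiable (at x)"
  shows "partial i (\<lambda>x. exp (f x)) x = exp (f x) * partial i f x"
    and "(\<lambda>x. exp (f x)) differentiable (at x)"
proof -
  have "((\<lambda>x. exp (f x)) has_derivative
      (\<lambda>h. exp (f x) * frechet_derivative f (at x) h)) (at x)"
    using assms by (auto intro!: derivative_eq_intros simp: frechet_derivative_works)
  from frechet_derivative_at[OF this] this
  show "partial i (\<lambda>x. exp (f x)) x = exp (f x) * partial i f x"
    and "(\<lambda>x. exp (f x)) differentiable (at x)"
    by (auto simp: partial_def fun_eq_iff differentiable_def)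
qed

lemma times_diff_add:
  assumes "open S" "times_diff n S f" "times_diff n S g"
  shows "times_diff n S (\<lambda>x. f x + g x)"
  using assms(2,3)
proof (induction n arbitrary: f g)
  case (Suc n)
  have "times_diff n S (partial i (\<lambda>x. f x + g x))" for i
    by (rule times_diff_cong[OF assms(1) _ Suc.IH[of "partial i f" "partial i g"]])
      (use Suc.prems in \<open>auto simp: partial_add\<close>)
  then show ?case
    using Suc.prems by simp
qed simp

lemma times_diff_mult:
  fixes f g :: "real^'n::finite \<Rightarrow> real"
  assumes "open S" "times_diff n S f" "times_diff n S g"
  shows "times_diff n S (\<lambda>x. f x * g x)"
  using assms(2,3)
proof (induction n arbitrary: f g)
  case (Suc n)
  have "times_diff n S (partial i (\<lambda>x. f x * g x))" for i
  proof (rule times_diff_cong[OF assms(1)])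
    \<comment> \<open>The product rule keeps one factor undifferentiated; it must be lowered to
      level \<open>n\<close> for the induction hypothesis to apply.\<close>
    have "times_diff n S f" "times_diff n S g"
      using Suc.prems times_diff_lower by blast+
    then show "times_diff n S (\<lambda>x. f x * partial i g x + partial i f x * g x)"
      using Suc.prems by (intro times_diff_add[OF assms(1)] Suc.IH) auto
  qed (use Suc.prems in \<open>auto simp: partial_mult\<close>)
  then show ?case
    using Suc.prems by simp
qed simp

text \<open>The derivative reproduces \<open>exp (f x)\<close> as a factor, which the induction
  hypothesis for the same \<open>f\<close> covers at level \<open>n\<close>; the product rule does
  the rest.\<close>

lemma times_diff_exp:
  fixes f :: "real^'n::finite \<Rightarrow> real"
  assumes "open S" "times_diff n S f"
  shows "times_diff n S (\<lambda>x. exp (f x))"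
  using assms(2)
proof (induction n arbitrary: f)
  case (Suc n)
  have "times_diff n S (partial i (\<lambda>x. exp (f x)))" for i
  proof (rule times_diff_cong[OF assms(1)])
    have "times_diff n S f"
      using Suc.prems times_diff_lower by blast
    then show "times_diff n S (\<lambda>x. exp (f x) * partial i f x)"
      using Suc.prems by (intro times_diff_mult[OF assms(1)] Suc.IH) auto
  qed (use Suc.prems in \<open>auto simp: partial_exp\<close>)
  then show ?case
    using Suc.prems by (simp add: partial_exp)
qed (simp add: partial_exp)

lemma smooth_on_const: "smooth_on S (\<lambda>x. c)"
proof -
  have "times_diff n S (\<lambda>x. c)" for n
    by (induction n arbitrary: c) (auto simp: partial_const)
  then show ?thesis
    by (simp add: smooth_on_iff_times_diff)
qed

lemma smooth_on_add: "open S \<Longrightarrow> smooth_on S f \<Longrightarrow> smooth_on S g \<Longrightarrow> smooth_on S (\<lambda>x. f x + g x)"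
  by (simp add: smooth_on_iff_times_diff times_diff_add)

lemma smooth_on_mult:
  fixes f g :: "real^'n::finite \<Rightarrow> real"
  shows "open S \<Longrightarrow> smooth_on S f \<Longrightarrow> smooth_on S g \<Longrightarrow> smooth_on S (\<lambda>x. f x * g x)"
  by (simp add: smooth_on_iff_times_diff times_diff_mult)

lemma smooth_on_exp:
  fixes f :: "real^'n::finite \<Rightarrow> real"
  shows "open S \<Longrightarrow> smooth_on S f \<Longrightarrow> smooth_on S (\<lambda>x. exp (f x))"
  by (simp add: smooth_on_iff_times_diff times_diff_exp)

section \<open>Smooth functions and tangent vectors on manifolds\<close>

lemma smooth_manifold_chart:
  assumes "smooth_manifold M" "(U, \<phi>) \<in> atlas M"
  shows "openin (mtop M) U" "open (\<phi> ` U)" "inj_on \<phi> U"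
    "homeomorphic_map (subtopology (mtop M) U) (top_of_set (\<phi> ` U)) \<phi>"
proof -
  have "is_chart (mtop M) (U, \<phi>)"
    using assms unfolding smooth_manifold_def by blast
  then show *: "openin (mtop M) U" "open (\<phi> ` U)"
    "homeomorphic_map (subtopology (mtop M) U) (top_of_set (\<phi> ` U)) \<phi>"
    by (auto simp: is_chart_def)
  show "inj_on \<phi> U"
    using homeomorphic_imp_injective_map[OF *(3)] openin_subset[OF *(1)]
    by (simp add: Int_absorb1)
qed

lemma open_chart_image:
  assumes "smooth_manifold M" "(U, \<phi>) \<in> atlas M" "openin (mtop M) W"
  shows "open (\<phi> ` (U \<inter> W))"
proof -
  note c = smooth_manifold_chart[OF assms(1,2)]
  have "openin (subtopology (mtop M) U) (U \<inter> W)"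
    using assms(3) openin_subtopology_Int2 by blast
  then have "openin (top_of_set (\<phi> ` U)) (\<phi> ` (U \<inter> W))"
    using homeomorphic_imp_open_map[OF c(4)] by (simp add: open_map_def)
  then show ?thesis
    using c(2) openin_open_eq by blast
qed

lemma smooth_manifold_covers:
  assumes "smooth_manifold M" "p \<in> pts M"
  obtains U \<phi> where "(U, \<phi>) \<in> atlas M" "p \<in> U"
  using assms unfolding smooth_manifold_def by blast

lemma smooth_manifold_maximal:
  assumes "smooth_manifold M" "is_chart (mtop M) c" "\<And>d. d \<in> atlas M \<Longrightarrow> compatible c d"
  shows "c \<in> atlas M"
proof -
  have "\<forall>c. is_chart (mtop M) c \<and> (\<forall>d\<in>atlas M. compatible c d) \<longrightarrow> c \<in> atlas M"
    using assms(1) unfolding smooth_manifold_def by (elim conjE)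
  then show ?thesis
    using assms(2,3) by blast
qed

lemma smooth_fun_onD:
  "smooth_fun_on M W h \<Longrightarrow> (U, \<phi>) \<in> atlas M \<Longrightarrow> smooth_on (\<phi> ` (U \<inter> W)) (h \<circ> inv_into U \<phi>)"
  unfolding smooth_fun_on_def by blast

lemma smooth_fun_on_subset: "smooth_fun_on M W h \<Longrightarrow> W' \<subseteq> W \<Longrightarrow> smooth_fun_on M W' h"
  unfolding smooth_fun_on_def by (blast intro: smooth_on_subset)

lemma smooth_fun_on_const: "smooth_fun_on M W (\<lambda>p. c)"
  unfolding smooth_fun_on_def comp_def by (auto intro: smooth_on_const)

context
  fixes M :: "('a, 'n::finite, 'z) mfd_scheme" and W :: "'a set"
  assumes M: "smooth_manifold M" and W: "openin (mtop M) W"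
begin

lemma smooth_fun_on_add:
  "smooth_fun_on M W h \<Longrightarrow> smooth_fun_on M W k \<Longrightarrow> smooth_fun_on M W (\<lambda>p. h p + k p)"
  unfolding smooth_fun_on_def comp_def
  by (auto intro!: smooth_on_add open_chart_image[OF M _ W])

lemma smooth_fun_on_mult:
  "smooth_fun_on M W h \<Longrightarrow> smooth_fun_on M W k \<Longrightarrow> smooth_fun_on M W (\<lambda>p. h p * k p)"
  unfolding smooth_fun_on_def comp_def
  by (auto intro!: smooth_on_mult open_chart_image[OF M _ W])

lemma smooth_fun_on_exp: "smooth_fun_on M W h \<Longrightarrow> smooth_fun_on M W (\<lambda>p. exp (h p))"
  unfolding smooth_fun_on_def comp_def
  by (auto intro!: smooth_on_exp open_chart_image[OF M _ W])

lemma smooth_fun_on_cong: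
  assumes "smooth_fun_on M W h" "\<And>p. p \<in> W \<Longrightarrow> h p = k p"
  shows "smooth_fun_on M W k"
  unfolding smooth_fun_on_def
proof clarify
  fix U \<phi> assume c: "(U, \<phi>) \<in> atlas M"
  show "smooth_on (\<phi> ` (U \<inter> W)) (k \<circ> inv_into U \<phi>)"
    by (rule smooth_on_cong[OF open_chart_image[OF M c W] _ smooth_fun_onD[OF assms(1) c]])
      (use assms(2) smooth_manifold_chart(3)[OF M c] in auto)
qed

end

lemma C_inf_scale:
  assumes "smooth_manifold M" "u \<in> C_inf M"
  shows "(\<lambda>p. c * u p) \<in> C_inf M"
  using assms smooth_fun_on_mult[OF assms(1) openin_topspace smooth_fun_on_const, of u c]
  by (simp add: C_inf_def)

lemma C_inf_exp_mult:
  assumes "smooth_manifold M" "u \<in> C_inf M" "\<Upsilon> \<in> C_inf M"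
  shows "exp_mult a \<Upsilon> u \<in> C_inf M"
proof -
  have "smooth_fun_on M (pts M) (\<lambda>p. exp (a * \<Upsilon> p) * u p)"
    using assms(2) C_inf_scale[OF assms(1,3), of a]
    by (auto simp: C_inf_def intro!: smooth_fun_on_mult[OF assms(1) openin_topspace]
        smooth_fun_on_exp[OF assms(1) openin_topspace] smooth_fun_on_const)
  then show ?thesis
    using assms by (simp add: C_inf_def exp_mult_def)
qed

section \<open>Germs of smooth functions and derivations\<close>

lemma smooth_near_add:
  assumes "smooth_manifold M" "smooth_near M p h" "smooth_near M p k"
  shows "smooth_near M p (\<lambda>q. h q + k q)"
proof -
  obtain V W where *: "p \<in> V" "openin (mtop M) V" "smooth_fun_on M V h"
    "p \<in> W" "openin (mtop M) W" "smooth_fun_on M W k"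
    using assms unfolding smooth_near_def by blast
  then have "smooth_fun_on M (V \<inter> W) (\<lambda>q. h q + k q)"
    by (intro smooth_fun_on_add assms) (auto intro: smooth_fun_on_subset)
  then show ?thesis
    unfolding smooth_near_def using * by blast
qed

lemma smooth_near_mult:
  assumes "smooth_manifold M" "smooth_near M p h" "smooth_near M p k"
  shows "smooth_near M p (\<lambda>q. h q * k q)"
proof -
  obtain V W where *: "p \<in> V" "openin (mtop M) V" "smooth_fun_on M V h"
    "p \<in> W" "openin (mtop M) W" "smooth_fun_on M W k"
    using assms unfolding smooth_near_def by blast
  then have "smooth_fun_on M (V \<inter> W) (\<lambda>q. h q * k q)"
    by (intro smooth_fun_on_mult assms) (auto intro: smooth_fun_on_subset)
  then show ?thesis
    unfolding smooth_near_def using * by blast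
qed

lemma smooth_near_const: "p \<in> pts M \<Longrightarrow> smooth_near M p (\<lambda>q. c)"
  unfolding smooth_near_def by (blast intro: smooth_fun_on_const)

lemma smooth_near_in_pts: "smooth_near M p h \<Longrightarrow> p \<in> pts M"
  unfolding smooth_near_def using openin_subset by blast

lemma smooth_near_scale:
  assumes "smooth_manifold M" "smooth_near M p h"
  shows "smooth_near M p (\<lambda>q. a * h q)"
  using smooth_near_mult[OF assms(1) smooth_near_const[OF smooth_near_in_pts[OF assms(2)]] assms(2)] .

lemma smooth_near_cong:
  assumes "smooth_manifold M" "smooth_near M p h"
    and "openin (mtop M) W" "p \<in> W" "\<And>q. q \<in> W \<Longrightarrow> h q = k q"
  shows "smooth_near M p k"
proof -
  obtain V where V: "p \<in> V" "openin (mtop M) V" "smooth_fun_on M V h"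
    using assms unfolding smooth_near_def by blast
  have "smooth_fun_on M (V \<inter> W) k"
  proof (rule smooth_fun_on_cong[OF assms(1)])
    show "smooth_fun_on M (V \<inter> W) h"
      using V(3) by (rule smooth_fun_on_subset) blast
  qed (use V assms(3,5) in auto)
  then show ?thesis
    unfolding smooth_near_def using V assms by blast
qed

lemma tangentD:
  assumes "v \<in> tangent M p"
  shows "smooth_near M p h \<Longrightarrow> smooth_near M p k \<Longrightarrow> v (\<lambda>q. h q + k q) = v h + v k"
    and "smooth_near M p h \<Longrightarrow> smooth_near M p k \<Longrightarrow> v (\<lambda>q. h q * k q) = h p * v k + k p * v h"
    and "smooth_near M p h \<Longrightarrow> v (\<lambda>q. a * h q) = a * v h"
    and "\<not> smooth_near M p h \<Longrightarrow> v h = 0"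
  using assms unfolding tangent_def by blast+

lemma tangent_lincomb:
  assumes "v \<in> tangent M p" "w \<in> tangent M p"
  shows "(\<lambda>h. a * v h + b * w h) \<in> tangent M p"
  unfolding tangent_def
  by (auto simp: tangentD[OF assms(1)] tangentD[OF assms(2)] algebra_simps)

text \<open>The difference \<open>d\<close> vanishes on \<open>W\<close>, and \<open>e\<close> is
  the indicator of the complement of \<open>W\<close>. Hence \<open>d = e * d\<close> everywhere
  while both factors vanish at \<open>p\<close>, and the Leibniz rule forces
  \<open>v d = 0\<close>.\<close>

lemma tangent_germ:
  assumes "smooth_manifold M" "v \<in> tangent M p" "smooth_near M p h"
    and W: "openin (mtop M) W" "p \<in> W" "\<And>q. q \<in> W \<Longrightarrow> h q = k q"
  shows "v h = v k"
proof -
  define d where "d q = k q + (-1) * h q" for q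
  define e where "e q = (if q \<in> W then 0::real else 1)" for q
  have k: "smooth_near M p k"
    using smooth_near_cong[OF assms(1,3) W] .
  have d: "smooth_near M p d"
    unfolding d_def by (intro smooth_near_add smooth_near_scale assms k)
  have e: "smooth_near M p e"
    by (rule smooth_near_cong[OF assms(1) smooth_near_const W(1,2)])
      (auto simp: e_def smooth_near_in_pts[OF k])
  have "d = (\<lambda>q. e q * d q)"
    using W(3) by (auto simp: e_def d_def fun_eq_iff)
  then have "v d = e p * v d + d p * v e"
    using tangentD(2)[OF assms(2) e d] by simp
  also have "\<dots> = 0"
    using W by (simp add: e_def d_def)
  finally have "v d = 0" .
  moreover have "v d = v k + (-1) * v h"
    unfolding d_def using tangentD(1)[OF assms(2) k smooth_near_scale[OF assms(1,3)]]
      tangentD(3)[OF assms(2,3)] by metis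
  ultimately show ?thesis by simp
qed

lemma smooth_near_differentiable:
  assumes "smooth_manifold M" "(U, \<phi>) \<in> atlas M" "p \<in> U" "smooth_near M p h"
  shows "(\<lambda>x. h (inv_into U \<phi> x)) differentiable (at (\<phi> p))"
proof -
  obtain W where "p \<in> W" "smooth_fun_on M W h"
    using assms(4) unfolding smooth_near_def by blast
  then show ?thesis
    using smooth_fun_onD[OF _ assms(2), of W h] assms(3)
    unfolding smooth_on_def comp_def by (auto dest: spec[of _ "[]"])
qed

text \<open>\<open>pullback_riem\<close> sets the metric to 0 off tangent vectors, so its components
  can be evaluated only once coordinate vectors are known to be tangent.\<close>

lemma coord_vec_tangent:
  assumes "smooth_manifold M" "(U, \<phi>) \<in> atlas M" "p \<in> U"
  shows "coord_vec M (U, \<phi>) p i \<in> tangent M p"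
proof -
  note diff = smooth_near_differentiable[OF assms]
  have inv: "inv_into U \<phi> (\<phi> p) = p"
    using smooth_manifold_chart(3)[OF assms(1,2)] assms(3) by simp
  have p: "p \<in> pts M"
    using smooth_manifold_chart(1)[OF assms(1,2)] assms(3) openin_subset by blast
  show ?thesis
    unfolding tangent_def coord_vec_def
    using assms(1)
    by (auto simp: comp_def smooth_near_add smooth_near_mult smooth_near_scale inv
        partial_add partial_mult partial_cmult partial_const diff)
qed

section \<open>Diffeomorphisms between open subsets\<close>

text \<open>The inverse \<open>g\<close> is a parameter and its smoothness an assumption, so the
  data are symmetric: through \<open>sym\<close>, every fact about \<open>f\<close> is also one
  about \<open>g\<close>.\<close>

locale diffeo_between =
  fixes N :: "('a, 'n::finite, 'y) mfd_scheme" and M :: "('a, 'n, 'z) mfd_scheme"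
    and W W' :: "'a set" and f g :: "'a \<Rightarrow> 'a"
  assumes N: "smooth_manifold N" and M: "smooth_manifold M"
    and W: "openin (mtop N) W" and W': "openin (mtop M) W'"
    and homeo: "homeomorphic_maps (subtopology (mtop N) W) (subtopology (mtop M) W') f g"
    and smooth: "\<And>U \<phi> V \<psi>. (U, \<phi>) \<in> atlas N \<Longrightarrow> (V, \<psi>) \<in> atlas M \<Longrightarrow>
      smooth_on (\<phi> ` {q \<in> U \<inter> W. f q \<in> V}) (\<psi> \<circ> f \<circ> inv_into U \<phi>)"
    and smooth': "\<And>U \<phi> V \<psi>. (U, \<phi>) \<in> atlas N \<Longrightarrow> (V, \<psi>) \<in> atlas M \<Longrightarrow>
      smooth_on (\<psi> ` {q \<in> V \<inter> W'. g q \<in> U}) (\<phi> \<circ> g \<circ> inv_into V \<psi>)"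
begin

lemma sym: "diffeo_between M N W' W g f"
  using N M W W' homeo smooth smooth' homeomorphic_maps_sym
  by unfold_locales blast+

lemma topspace_W: "topspace (subtopology (mtop N) W) = W"
  and topspace_W': "topspace (subtopology (mtop M) W') = W'"
  using openin_subset[OF W] openin_subset[OF W'] by auto

lemma f_in: "q \<in> W \<Longrightarrow> f q \<in> W'" and gf: "q \<in> W \<Longrightarrow> g (f q) = q"
  and g_in: "q \<in> W' \<Longrightarrow> g q \<in> W" and fg: "q \<in> W' \<Longrightarrow> f (g q) = q"
  using homeo topspace_W topspace_W'
  unfolding homeomorphic_maps_def continuous_map_def by auto

lemma openin_preimage:
  assumes "openin (mtop M) V"
  shows "openin (mtop N) {q \<in> W. f q \<in> V}"
proof -
  have "openin (subtopology (mtop M) W') (W' \<inter> V)"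
    using assms openin_subtopology_Int2 by blast
  then have "openin (subtopology (mtop N) W) {q \<in> W. f q \<in> W' \<inter> V}"
    using homeo topspace_W unfolding homeomorphic_maps_def continuous_map_def by metis
  moreover have "{q \<in> W. f q \<in> W' \<inter> V} = {q \<in> W. f q \<in> V}"
    using f_in by blast
  ultimately show ?thesis
    using W openin_trans_full by metis
qed

lemma image_eq: "A \<subseteq> W \<Longrightarrow> f ` A = {q \<in> W'. g q \<in> A}"
  using f_in gf g_in fg by (auto simp: image_iff) (metis subsetD)+

lemma openin_image:
  assumes "openin (mtop N) A" "A \<subseteq> W"
  shows "openin (mtop M) (f ` A)"
  using diffeo_between.openin_preimage[OF sym assms(1)] image_eq[OF assms(2)] by simp

lemma image_transport: "(\<phi> \<circ> g) ` f ` (U \<inter> W) = \<phi> ` (U \<inter> W)"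
  using gf by (force simp: image_iff)

text \<open>Consequently \<open>h\<close> has in the transported chart the same coordinate
  expression as \<open>h \<circ> f\<close> in the original one. All transfers between the two
  manifolds rest on this equation.\<close>

lemma inv_into_transport:
  assumes "inj_on \<phi> U" "x \<in> \<phi> ` (U \<inter> W)"
  shows "inv_into (f ` (U \<inter> W)) (\<phi> \<circ> g) x = f (inv_into U \<phi> x)"
proof (rule inv_into_f_eq)
  show "inj_on (\<phi> \<circ> g) (f ` (U \<inter> W))"
    using assms(1) gf by (auto simp: inj_on_def)
qed (use assms gf in auto)

text \<open>Components of pulled back objects in a chart literally agree with components in the
  transported chart, so that no transformation law under a change of coordinates is needed.\<close>

lemma transport_chart:
  assumes c: "(U, \<phi>) \<in> atlas N"
  shows "(f ` (U \<inter> W), \<phi> \<circ> g) \<in> atlas M"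
proof -
  note U = smooth_manifold_chart[OF N c]
  let ?U = "f ` (U \<inter> W)"
  have oU: "openin (mtop M) ?U"
    using U(1) W by (intro openin_image) auto
  have sub: "?U \<subseteq> W'"
    using f_in by blast
  have op: "open (\<phi> ` (U \<inter> W))"
    by (rule open_chart_image[OF N c W])
  have inv: "inv_into ?U (\<phi> \<circ> g) x = f (inv_into U \<phi> x)" if "x \<in> \<phi> ` (U \<inter> W)" for x
    using inv_into_transport[OF U(3) that] .
  have "homeomorphic_map (subtopology (mtop M) W') (subtopology (mtop N) W) g"
    using homeo homeomorphic_maps_sym homeomorphic_map_maps by blast
  then have "homeomorphic_map (subtopology (subtopology (mtop M) W') ?U)
      (subtopology (subtopology (mtop N) W) (U \<inter> W)) g"
  proof (rule homeomorphic_map_subtopologies)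
    show "g ` (topspace (subtopology (mtop M) W') \<inter> ?U) =
        topspace (subtopology (mtop N) W) \<inter> (U \<inter> W)"
    proof -
      have "g ` ?U = U \<inter> W"
        using gf by (force simp: image_iff)
      then show ?thesis
        using sub by (simp only: topspace_W topspace_W') (simp add: Int_absorb1)
    qed
  qed
  then have g: "homeomorphic_map (subtopology (mtop M) ?U) (subtopology (mtop N) (U \<inter> W)) g"
    using sub by (simp add: subtopology_subtopology Int_absorb1 Int_absorb2 Int_ac)
  have "homeomorphic_map (subtopology (subtopology (mtop N) U) (U \<inter> W))
      (subtopology (top_of_set (\<phi> ` U)) (\<phi> ` (U \<inter> W))) \<phi>"
    by (rule homeomorphic_map_subtopologies[OF U(4)])
      (use openin_subset[OF U(1)] in auto)
  then have "homeomorphic_map (subtopology (mtop N) (U \<inter> W)) (top_of_set (\<phi> ` (U \<inter> W))) \<phi>"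
    by (simp add: subtopology_subtopology Int_absorb1 image_mono)
  from homeomorphic_map_compose[OF g this]
  have "is_chart (mtop M) (?U, \<phi> \<circ> g)"
    using oU op unfolding is_chart_def prod.case image_transport by blast
  \<comment> \<open>The two transition maps are the coordinate expressions of \<open>f\<close> and
    \<open>g\<close> in the charts \<open>\<phi>\<close> and \<open>\<psi>\<close>, so compatibility
    amounts to \<open>smooth\<close> and \<open>smooth'\<close>.\<close>
  moreover have "compatible (?U, \<phi> \<circ> g) (V, \<psi>)" if d: "(V, \<psi>) \<in> atlas M" for V \<psi>
  proof -
    have eq: "(\<phi> \<circ> g) ` (?U \<inter> V) = \<phi> ` {q \<in> U \<inter> W. f q \<in> V}"
      using gf by (force simp: image_iff)
    have eq': "\<psi> ` (?U \<inter> V) = \<psi> ` {q \<in> V \<inter> W'. g q \<in> U}"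
      using image_eq[of "U \<inter> W"] g_in by (intro arg_cong[of _ _ "(`) \<psi>"]) auto
    have V: "openin (mtop M) V"
      using smooth_manifold_chart(1)[OF M d] .
    have "open (\<phi> ` (U \<inter> {q \<in> W. f q \<in> V}))"
      by (rule open_chart_image[OF N c openin_preimage[OF V]])
    moreover have "U \<inter> {q \<in> W. f q \<in> V} = {q \<in> U \<inter> W. f q \<in> V}"
      by blast
    ultimately have "open (\<phi> ` {q \<in> U \<inter> W. f q \<in> V})"
      by simp
    then have "smooth_on (\<phi> ` {q \<in> U \<inter> W. f q \<in> V}) (\<psi> \<circ> inv_into ?U (\<phi> \<circ> g))"
      by (rule smooth_on_cong[OF _ _ smooth[OF c d]]) (subst comp_def, subst inv, auto)
    then show ?thesis
      using smooth'[OF c d] unfolding compatible_def prod.case eq eq' Int_commute[of V] by blast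
  qed
  ultimately show ?thesis
    using smooth_manifold_maximal[OF M] by auto
qed

text \<open>Smoothness of \<open>h\<close> is tested in the transported chart alone, where its
  coordinate expression is already that of \<open>h \<circ> f\<close>; smooth maps are never
  composed.\<close>

lemma smooth_fun_on_transport:
  assumes V: "openin (mtop M) V" and h: "smooth_fun_on M V h"
  shows "smooth_fun_on N {q \<in> W. f q \<in> V} (h \<circ> f)"
  unfolding smooth_fun_on_def
proof clarify
  fix U \<phi> assume c: "(U, \<phi>) \<in> atlas N"
  have "(\<phi> \<circ> g) ` (f ` (U \<inter> W) \<inter> V) = \<phi> ` (U \<inter> {q \<in> W. f q \<in> V})"
    using gf by (force simp: image_iff)
  with smooth_fun_onD[OF h transport_chart[OF c]]
  have "smooth_on (\<phi> ` (U \<inter> {q \<in> W. f q \<in> V})) (h \<circ> inv_into (f ` (U \<inter> W)) (\<phi> \<circ> g))"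
    by simp
  then show "smooth_on (\<phi> ` (U \<inter> {q \<in> W. f q \<in> V})) (h \<circ> f \<circ> inv_into U \<phi>)"
    by (rule smooth_on_cong[OF open_chart_image[OF N c openin_preimage[OF V]], rotated])
      (use inv_into_transport[OF smooth_manifold_chart(3)[OF N c]] in auto)
qed

section \<open>Germs and tangent vectors under a diffeomorphism\<close>

lemma smooth_near_transport:
  assumes "p \<in> W" "smooth_near M (f p) h"
  shows "smooth_near N p (h \<circ> f)"
proof -
  obtain V where V: "f p \<in> V" "openin (mtop M) V" "smooth_fun_on M V h"
    using assms(2) unfolding smooth_near_def by blast
  show ?thesis
    unfolding smooth_near_def
  proof (intro exI conjI)
    show "p \<in> {q \<in> W. f q \<in> V}"
      using assms(1) V(1) by simp
  qed (rule openin_preimage[OF V(2)] smooth_fun_on_transport[OF V(2,3)])+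
qed

lemma pushforward_tangent:
  assumes "p \<in> W" "v \<in> tangent N p"
  shows "pushforward M f p v \<in> tangent M (f p)"
  unfolding tangent_def pushforward_def
  using tangentD[OF assms(2)] smooth_near_transport[OF assms(1)]
  by (auto simp: comp_def smooth_near_add[OF M] smooth_near_mult[OF M] smooth_near_scale[OF M])

text \<open>Near \<open>p\<close>, a germ \<open>h\<close> equals
  \<open>(h \<circ> g) \<circ> f\<close>, so \<open>v h\<close> is a value of the pushforward. This
  injectivity makes the pullback metric positive definite.\<close>

lemma pushforward_eq_0:
  assumes "p \<in> W" "v \<in> tangent N p" "pushforward M f p v = (\<lambda>h. 0)"
  shows "v = (\<lambda>h. 0)"
proof
  fix h
  show "v h = 0"
  proof (cases "smooth_near N p h")
    case True
    then have *: "smooth_near M (f p) (h \<circ> g)"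
      using diffeo_between.smooth_near_transport[OF sym, of "f p" h] assms(1) f_in gf by simp
    have "v h = v (h \<circ> g \<circ> f)"
      by (rule tangent_germ[OF N assms(2) True W assms(1)]) (simp add: gf)
    also have "\<dots> = pushforward M f p v (h \<circ> g)"
      using * by (simp add: pushforward_def)
    finally show ?thesis
      using assms(3) by simp
  qed (use tangentD(4)[OF assms(2)] in simp)
qed

text \<open>In these two charts the Jacobian matrix of \<open>f\<close> is the identity. On
  functions that are not smooth near \<open>f p\<close>, both sides are 0 by convention.\<close>

lemma pushforward_coord_vec:
  assumes c: "(U, \<phi>) \<in> atlas N" and p: "p \<in> U \<inter> W"
  shows "pushforward M f p (coord_vec N (U, \<phi>) p i) = coord_vec M (f ` (U \<inter> W), \<phi> \<circ> g) (f p) i"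
proof
  fix h :: "'a \<Rightarrow> real"
  have "partial i (h \<circ> f \<circ> inv_into U \<phi>) (\<phi> p) =
      partial i (h \<circ> inv_into (f ` (U \<inter> W)) (\<phi> \<circ> g)) (\<phi> p)"
    by (rule partial_cong[OF open_chart_image[OF N c W]])
      (use p inv_into_transport[OF smooth_manifold_chart(3)[OF N c]] in auto)
  then show "pushforward M f p (coord_vec N (U, \<phi>) p i) h =
      coord_vec M (f ` (U \<inter> W), \<phi> \<circ> g) (f p) i h"
    using p smooth_near_transport[of p h] gf by (simp add: pushforward_def coord_vec_def)
qed

end

section \<open>Local diffeomorphisms and the pullback of functions\<close>

lemma local_diffeo_imp_diffeo_between:
  assumes "smooth_manifold N" "smooth_manifold M" "local_diffeo N M f" "p \<in> pts N"
  obtains W where "p \<in> W" "diffeo_between N M W (f ` W) f (inv_into W f)"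
proof -
  obtain W where W: "p \<in> W" "openin (mtop N) W" "openin (mtop M) (f ` W)"
    "homeomorphic_map (subtopology (mtop N) W) (subtopology (mtop M) (f ` W)) f"
    and smooth: "\<forall>(U, \<phi>)\<in>atlas N. \<forall>(V, \<psi>)\<in>atlas M.
        smooth_on (\<phi> ` {q \<in> U \<inter> W. f q \<in> V}) (\<psi> \<circ> f \<circ> inv_into U \<phi>) \<and>
        smooth_on (\<psi> ` (V \<inter> f ` (U \<inter> W))) (\<phi> \<circ> inv_into W f \<circ> inv_into V \<psi>)"
    using assms(3,4) unfolding local_diffeo_def by blast
  have inj: "inj_on f W"
    using homeomorphic_imp_injective_map[OF W(4)] openin_subset[OF W(2)]
    by (simp add: Int_absorb1)
  obtain g where g: "homeomorphic_maps (subtopology (mtop N) W) (subtopology (mtop M) (f ` W)) f g"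
    using W(4) homeomorphic_map_maps by blast
  then have "g y = inv_into W f y" if "y \<in> f ` W" for y
    using that inj openin_subset[OF W(2)] by (auto simp: homeomorphic_maps_def)
  then have "homeomorphic_maps (subtopology (mtop N) W) (subtopology (mtop M) (f ` W)) f (inv_into W f)"
    by (intro homeomorphic_maps_eq[OF g]) auto
  moreover have "V \<inter> f ` (U \<inter> W) = {q \<in> V \<inter> f ` W. inv_into W f q \<in> U}" for U V
    using inj by auto
  ultimately have "diffeo_between N M W (f ` W) f (inv_into W f)"
    using assms W smooth by unfold_locales auto
  then show ?thesis
    using that W(1) by blast
qed

lemma C_inf_pullback:
  assumes "smooth_manifold N" "smooth_manifold M" "local_diffeo N M f" "u \<in> C_inf M"
  shows "pullback N f u \<in> C_inf N"
proof -
  have "smooth_on (\<phi> ` (U \<inter> pts N)) (pullback N f u \<circ> inv_into U \<phi>)" if c: "(U, \<phi>) \<in> atlas N" for U \<phi>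
  proof (rule smooth_on_local)
    fix x assume "x \<in> \<phi> ` (U \<inter> pts N)"
    then obtain p where p: "p \<in> U" "p \<in> pts N" "x = \<phi> p"
      by blast
    obtain W where "p \<in> W" and "diffeo_between N M W (f ` W) f (inv_into W f)"
      using local_diffeo_imp_diffeo_between[OF assms(1-3) p(2)] .
    then interpret diffeo_between N M W "f ` W" f "inv_into W f"
      by blast
    have "{q \<in> W. f q \<in> pts M} = W"
      using openin_subset[OF W'] by blast
    then have "smooth_fun_on N W (u \<circ> f)"
      using smooth_fun_on_transport[OF openin_topspace, of u] assms(4) by (simp add: C_inf_def)
    \<comment> \<open>Since \<open>W\<close> lies in \<open>pts N\<close>, the extension by zero
      does not intervene there.\<close>
    then have "smooth_fun_on N W (pullback N f u)"
      by (rule smooth_fun_on_cong[OF N W]) (use openin_subset[OF W] in \<open>auto simp: pullback_def\<close>)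
    then have "smooth_on (\<phi> ` (U \<inter> W)) (pullback N f u \<circ> inv_into U \<phi>)"
      by (rule smooth_fun_onD[OF _ c])
    moreover have "x \<in> \<phi> ` (U \<inter> W)"
      using p \<open>p \<in> W\<close> by blast
    ultimately show "\<exists>T. x \<in> T \<and> smooth_on T (pullback N f u \<circ> inv_into U \<phi>)"
      by metis
  qed
  then show ?thesis
    by (auto simp: C_inf_def smooth_fun_on_def pullback_def)
qed

section \<open>Pullback metrics\<close>

text \<open>\<open>N\<close> is a bare manifold, while its pullback record also carries a metric.
  The notions below read only the topology and the atlas, so they carry over verbatim.\<close>

lemma pullback_riem_simps [simp]:
  "mtop (pullback_riem N f M) = mtop N"
  "atlas (pullback_riem N f M) = atlas N"
  by (simp_all add: pullback_riem_def)

lemma smooth_fun_on_pullback_riem [simp]: "smooth_fun_on (pullback_riem N f M) = smooth_fun_on N"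
  by (simp add: smooth_fun_on_def fun_eq_iff)

lemma smooth_near_pullback_riem [simp]: "smooth_near (pullback_riem N f M) = smooth_near N"
  by (simp add: smooth_near_def fun_eq_iff)

lemma smooth_manifold_pullback_riem [simp]:
  "smooth_manifold (pullback_riem N f M) = smooth_manifold N"
  by (simp add: smooth_manifold_def)

lemma C_inf_pullback_riem [simp]: "C_inf (pullback_riem N f M) = C_inf N"
  by (simp add: C_inf_def)

lemma tangent_pullback_riem [simp]: "tangent (pullback_riem N f M) = tangent N"
  by (simp add: tangent_def fun_eq_iff)

lemma coord_vec_pullback_riem [simp]: "coord_vec (pullback_riem N f M) = coord_vec N"
  by (simp add: coord_vec_def)

text \<open>The pullback metric on coordinate vectors is the metric of \<open>M\<close> on their
  pushforwards, and these are the coordinate vectors of the transported chart.\<close>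

lemma gmat_pullback_riem:
  assumes "diffeo_between N M W W' f g" and c: "(U, \<phi>) \<in> atlas N" and x: "x \<in> \<phi> ` (U \<inter> W)"
  shows "gmat (pullback_riem N f M) (U, \<phi>) x = gmat M (f ` (U \<inter> W), \<phi> \<circ> g) x"
proof -
  interpret diffeo_between N M W W' f g
    by (rule assms)
  note U = smooth_manifold_chart[OF N c]
  obtain p where p: "p \<in> U \<inter> W" "x = \<phi> p"
    using x by blast
  have "inv_into U \<phi> x = p"
    using p U(3) by simp
  moreover have "inv_into (f ` (U \<inter> W)) (\<phi> \<circ> g) x = f p"
    using inv_into_transport[OF U(3) x] \<open>inv_into U \<phi> x = p\<close> by simp
  moreover have "p \<in> pts N"
    using p openin_subset[OF W] by blast
  ultimately show ?thesis
    using p pushforward_coord_vec[OF c p(1)] coord_vec_tangent[OF N c]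
    by (simp add: gmat_def Let_def) (simp add: pullback_riem_def)
qed

text \<open>This makes the universal formula applicable to the pullback. Algebraic properties come
  from linearity and injectivity of the pushforward, smoothness of the components from the
  transported charts.\<close>

lemma riemannian_manifold_pullback_riem:
  fixes N :: "('a, 'n::finite) mfd" and M :: "('a, 'n) riem"
  assumes N: "smooth_manifold N" and M: "riemannian_manifold M" and f: "local_diffeo N M f"
  shows "riemannian_manifold (pullback_riem N f M)"
proof -
  have sM: "smooth_manifold M"
    and symM: "\<And>p v w. p \<in> pts M \<Longrightarrow> v \<in> tangent M p \<Longrightarrow> w \<in> tangent M p \<Longrightarrow>
      metric M p v w = metric M p w v"
    and linM: "\<And>p v v' w a b. p \<in> pts M \<Longrightarrow> v \<in> tangent M p \<Longrightarrow> v' \<in> tangent M p \<Longrightarrow>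
      w \<in> tangent M p \<Longrightarrow>
      metric M p (\<lambda>h. a * v h + b * v' h) w = a * metric M p v w + b * metric M p v' w"
    and posM: "\<And>p v. p \<in> pts M \<Longrightarrow> v \<in> tangent M p \<Longrightarrow> v \<noteq> (\<lambda>h. 0) \<Longrightarrow> metric M p v v > 0"
    and smoothM: "\<And>U \<phi> i j. (U, \<phi>) \<in> atlas M \<Longrightarrow>
      smooth_on (\<phi> ` U) (\<lambda>x. gmat M (U, \<phi>) x $ i $ j)"
    using M unfolding riemannian_manifold_def by blast+
  have push: "f p \<in> pts M \<and> pushforward M f p v \<in> tangent M (f p) \<and>
      (v \<noteq> (\<lambda>h. 0) \<longrightarrow> pushforward M f p v \<noteq> (\<lambda>h. 0))"
    if p: "p \<in> pts N" and v: "v \<in> tangent N p" for p v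
  proof -
    obtain W where "p \<in> W" and "diffeo_between N M W (f ` W) f (inv_into W f)"
      using local_diffeo_imp_diffeo_between[OF N sM f p] .
    then interpret diffeo_between N M W "f ` W" f "inv_into W f"
      by blast
    show ?thesis
      using pushforward_tangent pushforward_eq_0 \<open>p \<in> W\<close> v openin_subset[OF W'] by blast
  qed
  have metric: "metric (pullback_riem N f M) p v w =
      metric M (f p) (pushforward M f p v) (pushforward M f p w)"
    if "p \<in> pts N" "v \<in> tangent N p" "w \<in> tangent N p" for p v w
    using that by (simp add: pullback_riem_def)
  \<comment> \<open>On functions not smooth near \<open>f p\<close> both sides are 0, so the
    identity holds for arbitrary \<open>v\<close> and \<open>v'\<close>.\<close>
  have lin: "pushforward M f p (\<lambda>h. a * v h + b * v' h) =
      (\<lambda>h. a * pushforward M f p v h + b * pushforward M f p v' h)" for p a v b v'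
    by (auto simp: pushforward_def)
  have smooth: "smooth_on (\<phi> ` U) (\<lambda>x. gmat (pullback_riem N f M) (U, \<phi>) x $ i $ j)"
    if c: "(U, \<phi>) \<in> atlas N" for U \<phi> i j
  proof (rule smooth_on_local)
    fix x assume "x \<in> \<phi> ` U"
    then obtain p where p: "p \<in> U" "p \<in> pts N" "x = \<phi> p"
      using smooth_manifold_chart(1)[OF N c] openin_subset by blast
    obtain W where "p \<in> W" and d: "diffeo_between N M W (f ` W) f (inv_into W f)"
      using local_diffeo_imp_diffeo_between[OF N sM f p(2)] .
    then interpret diffeo_between N M W "f ` W" f "inv_into W f"
      by blast
    have "smooth_on (\<phi> ` (U \<inter> W)) (\<lambda>x. gmat (pullback_riem N f M) (U, \<phi>) x $ i $ j)"
      by (rule smooth_on_cong[OF open_chart_image[OF N c W] _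
          smoothM[OF transport_chart[OF c], of i j, unfolded image_transport]])
        (simp add: gmat_pullback_riem[OF d c])
    moreover have "x \<in> \<phi> ` (U \<inter> W)"
      using p \<open>p \<in> W\<close> by blast
    ultimately show "\<exists>T. x \<in> T \<and> smooth_on T (\<lambda>x. gmat (pullback_riem N f M) (U, \<phi>) x $ i $ j)"
      by metis
  qed
  show ?thesis
    unfolding riemannian_manifold_def
  proof (intro conjI ballI allI impI; (unfold pullback_riem_simps tangent_pullback_riem)?)
    show "smooth_manifold (pullback_riem N f M)"
      using N by simp
  next
    fix p v w assume *: "p \<in> pts N" "v \<in> tangent N p" "w \<in> tangent N p"
    then show "metric (pullback_riem N f M) p v w = metric (pullback_riem N f M) p w v"
      using push symM by (simp add: metric)
  next
    fix p v v' w a b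
    assume *: "p \<in> pts N" "v \<in> tangent N p" "v' \<in> tangent N p" "w \<in> tangent N p"
    then show "metric (pullback_riem N f M) p (\<lambda>h. a * v h + b * v' h) w =
        a * metric (pullback_riem N f M) p v w + b * metric (pullback_riem N f M) p v' w"
      using push linM by (simp add: metric tangent_lincomb lin)
  next
    fix p v assume *: "p \<in> pts N" "v \<in> tangent N p" "v \<noteq> (\<lambda>h. 0)"
    then show "metric (pullback_riem N f M) p v v > 0"
      using push posM by (simp add: metric)
  next
    fix p v w assume "\<not> (p \<in> pts N \<and> v \<in> tangent N p \<and> w \<in> tangent N p)"
    then show "metric (pullback_riem N f M) p v w = 0"
      by (auto simp: pullback_riem_def)
  next
    show "case c of (U, \<phi>) \<Rightarrow>
        \<forall>i j. smooth_on (\<phi> ` U) (\<lambda>x. gmat (pullback_riem N f M) (U, \<phi>) x $ i $ j)"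
      if "c \<in> atlas N" for c
      using smooth that by auto
  qed
qed

section \<open>Naturality of polydifferential operators\<close>

text \<open>Two charts, in general on different manifolds, whose metric components agree on an open
  set of coordinate space. Agreement is carried along on all of \<open>S\<close> rather than at one
  point, because each further construction differentiates the previous one.\<close>

context
  fixes S :: "(real^'n::finite) set" and M M' :: "('a, 'n) riem" and c c' :: "('a, 'n) chart"
  assumes S: "open S" and gmat: "\<And>y. y \<in> S \<Longrightarrow> gmat M c y = gmat M' c' y"
begin

lemma christoffel_cong:
  assumes "x \<in> S"
  shows "christoffel M c l i j x = christoffel M' c' l i j x"
proof -
  have "partial i (\<lambda>y. gmat M c y $ j $ m) x = partial i (\<lambda>y. gmat M' c' y $ j $ m) x" for i j m
    by (rule partial_cong[OF S assms]) (simp add: gmat)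
  then show ?thesis
    by (simp add: christoffel_def gmat[OF assms])
qed

lemma riemann_cong:
  assumes "x \<in> S"
  shows "riemann M c is x = riemann M' c' is x"
proof -
  have "partial i (christoffel M c l j k) x = partial i (christoffel M' c' l j k) x" for i j k l
    by (rule partial_cong[OF S assms]) (rule christoffel_cong)
  then show ?thesis
    by (simp add: riemann_def Let_def gmat[OF assms] christoffel_cong[OF assms])
qed

lemma nabla_cong:
  assumes "\<And>is y. y \<in> S \<Longrightarrow> T is y = T' is y" "x \<in> S"
  shows "nabla M c T is x = nabla M' c' T' is x"
proof (cases "is")
  case (Cons k ks)
  have "partial k (T ks) x = partial k (T' ks) x"
    by (rule partial_cong[OF S assms(2)]) (rule assms(1))
  then show ?thesis
    by (simp add: Cons assms christoffel_cong)
qed simp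

lemma nabla_power_cong:
  assumes "\<And>is y. y \<in> S \<Longrightarrow> T is y = T' is y" "x \<in> S"
  shows "(nabla M c ^^ m) T is x = (nabla M' c' ^^ m) T' is x"
  using assms(2) by (induction m arbitrary: "is" x) (auto intro: assms(1) nabla_cong)

lemma eval_term_cong:
  assumes us: "list_all2 (\<lambda>u u'. \<forall>y\<in>S. u (inv_into (fst c) (snd c) y) = u' (inv_into (fst c') (snd c') y)) us us'"
    and x: "x \<in> S"
  shows "eval_term M c us x t = eval_term M' c' us' x t"
proof -
  obtain a Ps Ns \<sigma> where t: "t = (a, Ps, Ns, \<sigma>)"
    by (cases t)
  have Rm: "(nabla M c ^^ m) (riemann M c) is x = (nabla M' c' ^^ m) (riemann M' c') is x" for m "is"
    by (rule nabla_power_cong[OF riemann_cong x])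
  have "map2 (\<lambda>m u. (m, \<lambda>is. (nabla M c ^^ m) (\<lambda>_. u \<circ> inv_into (fst c) (snd c)) is x)) Ns us =
      map2 (\<lambda>m u. (m, \<lambda>is. (nabla M' c' ^^ m) (\<lambda>_. u \<circ> inv_into (fst c') (snd c')) is x)) Ns us'"
    using us
  proof (induction us us' arbitrary: Ns rule: list_all2_induct)
    case (Cons u us u' us')
    then have "(nabla M c ^^ m) (\<lambda>_. u \<circ> inv_into (fst c) (snd c)) is x =
        (nabla M' c' ^^ m) (\<lambda>_. u' \<circ> inv_into (fst c') (snd c')) is x" for m "is"
      by (intro nabla_power_cong x) auto
    with Cons show ?case
      by (cases Ns) (auto simp: comp_def)
  qed simp
  then show ?thesis
    by (simp add: t eval_term_def gmat[OF x] Rm)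
qed

end

text \<open>Both sides evaluate the same terms at the same coordinates \<open>\<phi> p\<close>: the
  left one in \<open>(U, \<phi>)\<close> at \<open>p\<close>, the right one in the transported chart
  at \<open>f p\<close>.\<close>

lemma polydiff_op_pullback:
  fixes N :: "('a, 'n::finite) mfd" and M :: "('a, 'n) riem"
  assumes C: "polydiff_op C" and N: "smooth_manifold N" and riemM: "riemannian_manifold M"
    and f: "local_diffeo N M f" and us: "us \<in> tuples (C_inf M) (rank C - 1)" and p: "p \<in> pts N"
  shows "opr C (pullback_riem N f M) (map (pullback N f) us) p = opr C M us (f p)"
proof -
  have sM: "smooth_manifold M"
    using riemM by (simp add: riemannian_manifold_def)
  obtain W where "p \<in> W" and d: "diffeo_between N M W (f ` W) f (inv_into W f)"
    using local_diffeo_imp_diffeo_between[OF N sM f p] .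
  then interpret diffeo_between N M W "f ` W" f "inv_into W f"
    by blast
  obtain U \<phi> where c: "(U, \<phi>) \<in> atlas N" and "p \<in> U"
    using smooth_manifold_covers[OF N p] .
  let ?g = "inv_into W f"
  let ?c = "(f ` (U \<inter> W), \<phi> \<circ> ?g)"
  have x: "\<phi> p \<in> \<phi> ` (U \<inter> W)" "f p \<in> f ` (U \<inter> W)" "(\<phi> \<circ> ?g) (f p) = \<phi> p"
    using \<open>p \<in> U\<close> \<open>p \<in> W\<close> gf by auto
  have us': "map (pullback N f) us \<in> tuples (C_inf (pullback_riem N f M)) (rank C - 1)"
    using us C_inf_pullback[OF N sM f] by (auto simp: tuples_def)
  \<comment> \<open>Universality enters here: one list \<open>ts\<close> serves all manifolds, in
    particular \<open>M\<close> and the pullback.\<close>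
  obtain ts where ts: "\<And>M us U \<phi> p. riemannian_manifold M \<Longrightarrow> us \<in> tuples (C_inf M) (rank C - 1) \<Longrightarrow>
      (U, \<phi>) \<in> atlas M \<Longrightarrow> p \<in> U \<Longrightarrow>
      opr C M us p = sum_list (map (eval_term M (U, \<phi>) us (\<phi> p)) ts)"
    using C unfolding polydiff_op_def by blast
  have "pullback N f u (inv_into U \<phi> y) = u (inv_into (f ` (U \<inter> W)) (\<phi> \<circ> ?g) y)"
    if "y \<in> \<phi> ` (U \<inter> W)" for u y
  proof -
    have "inv_into U \<phi> y \<in> pts N"
      using that inv_into_into[of y \<phi> U] openin_subset[OF smooth_manifold_chart(1)[OF N c]] by blast
    then show ?thesis
      using inv_into_transport[OF smooth_manifold_chart(3)[OF N c] that] by (simp add: pullback_def)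
  qed
  then have "eval_term (pullback_riem N f M) (U, \<phi>) (map (pullback N f) us) (\<phi> p) =
      eval_term M ?c us (\<phi> p)"
    using x(1) by (intro ext eval_term_cong[OF open_chart_image[OF N c W] gmat_pullback_riem[OF d c]])
      (auto simp: list_all2_map1 list.rel_refl)
  then show ?thesis
    using ts[OF riemannian_manifold_pullback_riem[OF N riemM f] us' _ \<open>p \<in> U\<close>, of \<phi>]
      ts[OF riemM us transport_chart[OF c] x(2)] c x(3) by simp
qed

text \<open>The arguments are scaled one at a time from the left, each contributing one factor
  \<open>c\<close>.\<close>

lemma multilinear_replicate_scale:
  assumes "multilinear M l F" "u \<in> C_inf M" "(\<lambda>p. c * u p) \<in> C_inf M"
  shows "F (replicate l (\<lambda>p. c * u p)) = (\<lambda>p. c ^ l * F (replicate l u) p)"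
proof -
  have "F (replicate j (\<lambda>p. c * u p) @ replicate (l - j) u) = (\<lambda>p. c ^ j * F (replicate l u) p)"
    if "j \<le> l" for j
    using that
  proof (induction j)
    case (Suc j)
    let ?us = "replicate j (\<lambda>p. c * u p) @ replicate (l - j) u"
    have l: "l - j = Suc (l - Suc j)"
      using Suc.prems by simp
    have us: "?us \<in> tuples (C_inf M) l" and j: "j < l"
      using Suc.prems assms(2,3) by (auto simp: tuples_def)
    \<comment> \<open>\<open>multilinear\<close> speaks of linear combinations with two terms, so
      the second one is added with coefficient 0.\<close>
    have "F (?us[j := (\<lambda>p. c * (?us ! j) p + 0 * u p)]) =
        (\<lambda>p. c * F ?us p + 0 * F (?us[j := u]) p)"
      using assms(1)[unfolded multilinear_def, THEN bspec, OF us, THEN conjunct2, rule_format,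
          OF j assms(2)] .
    moreover have "?us[j := (\<lambda>p. c * (?us ! j) p + 0 * u p)] =
        replicate (Suc j) (\<lambda>p. c * u p) @ replicate (l - Suc j) u"
      by (simp add: l list_update_append nth_append replicate_app_Cons_same)
    ultimately show ?case
      using Suc by (simp add: mult.assoc)
  qed simp
  from this[of l] show ?thesis by simp
qed

theorem lemma1p4:
  fixes D :: "('a, 'n::finite) polydiff" and \<C> :: "('a, 'n) polydiff set"
    and r :: nat and k :: real and M :: "('a, 'n) riem"
  assumes "constrained_op (D, \<C>) r k"
    and "riemannian_manifold M"
  shows "(\<forall>u\<in>U_set \<C> M. \<forall>c>0. (\<lambda>p. c * u p) \<in> U_set \<C> M) \<and>
    (\<forall>\<Upsilon>\<in>C_inf M. U_set \<C> (conformal \<Upsilon> M) =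
       exp_mult (- ((real CARD('n) - 2 * k) / real r)) \<Upsilon> ` U_set \<C> M) \<and>
    (\<forall>(N :: ('a, 'n) mfd) f. smooth_manifold N \<and> local_diffeo N M f \<longrightarrow>
       pullback N f ` U_set \<C> M \<subseteq> U_set \<C> (pullback_riem N f M))"
proof (intro conjI ballI allI impI)
  have sM: "smooth_manifold M"
    using assms(2) by (simp add: riemannian_manifold_def)
  have poly: "polydiff_op C" if "C \<in> \<C>" for C
    using assms(1) that by (auto simp: constrained_op_def)
  show "(\<lambda>p. c * u p) \<in> U_set \<C> M" if u: "u \<in> U_set \<C> M" and c: "c > 0" for u c
  proof -
    have uC: "u \<in> C_inf M"
      using u by (simp add: U_set_def)
    note cu = C_inf_scale[OF sM uC, of c]
    have "opr C M (replicate (rank C - 1) (\<lambda>p. c * u p)) =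
        (\<lambda>p. c ^ (rank C - 1) * opr C M (replicate (rank C - 1) u) p)" if "C \<in> \<C>" for C
      using poly[OF that] assms(2) unfolding polydiff_op_def
      by (intro multilinear_replicate_scale[OF _ uC cu]) blast
    \<comment> \<open>The factor \<open>c ^ (rank C - 1)\<close> is positive, also for rank 1, where
      it equals 1.\<close>
    then show ?thesis
      using u c cu by (simp add: U_set_def)
  qed
  show "U_set \<C> (conformal \<Upsilon> M) =
      exp_mult (- ((real CARD('n) - 2 * k) / real r)) \<Upsilon> ` U_set \<C> M" if Y: "\<Upsilon> \<in> C_inf M" for \<Upsilon>
  proof -
    define a where "a = (real CARD('n) - 2 * k) / real r"
    have conf: "pts (conformal \<Upsilon> M) = pts M" "C_inf (conformal \<Upsilon> M) = C_inf M"
      by (simp_all add: conformal_def C_inf_def smooth_fun_on_def)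
    have "\<exists>b. \<forall>u\<in>C_inf M. opr C (conformal \<Upsilon> M) (replicate (rank C - 1) u) =
        exp_mult b \<Upsilon> (opr C M (replicate (rank C - 1) (exp_mult a \<Upsilon> u)))" if "C \<in> \<C>" for C
      using assms that Y unfolding constrained_op_def a_def by auto blast
    \<comment> \<open>The weight \<open>b\<close> may vary with \<open>C\<close>, but its
      exponential factor is positive and leaves the sign unchanged.\<close>
    then have pos: "opr C (conformal \<Upsilon> M) (replicate (rank C - 1) u) p > 0 \<longleftrightarrow>
        opr C M (replicate (rank C - 1) (exp_mult a \<Upsilon> u)) p > 0" if "C \<in> \<C>" "u \<in> C_inf M" for C u p
      using that by (fastforce simp: exp_mult_def zero_less_mult_iff)
    note exp_C = C_inf_exp_mult[OF sM _ Y]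
    have inv: "exp_mult b \<Upsilon> (exp_mult (- b) \<Upsilon> u) = u" for b u
      by (simp add: exp_mult_def fun_eq_iff flip: mult.assoc exp_add)
    \<comment> \<open>The set for the conformal metric is thus a preimage under multiplication by
      \<open>exp (a * \<Upsilon> p)\<close>; since that map is invertible, it is also the image
      under multiplication by the reciprocal.\<close>
    have iff: "u \<in> U_set \<C> (conformal \<Upsilon> M) \<longleftrightarrow> u \<in> C_inf M \<and> exp_mult a \<Upsilon> u \<in> U_set \<C> M" for u
      using pos exp_C unfolding U_set_def conf by auto
    have "U_set \<C> (conformal \<Upsilon> M) = exp_mult (- a) \<Upsilon> ` U_set \<C> M"
    proof (intro equalityI subsetI)
      fix u assume "u \<in> U_set \<C> (conformal \<Upsilon> M)"
      then show "u \<in> exp_mult (- a) \<Upsilon> ` U_set \<C> M"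
        using iff inv[of "- a" u] by (intro image_eqI[of _ _ "exp_mult a \<Upsilon> u"]) auto
    next
      fix u assume "u \<in> exp_mult (- a) \<Upsilon> ` U_set \<C> M"
      then show "u \<in> U_set \<C> (conformal \<Upsilon> M)"
        using iff exp_C inv[of a] by (auto simp: U_set_def)
    qed
    then show ?thesis
      by (simp add: a_def)
  qed
  show "pullback N f ` U_set \<C> M \<subseteq> U_set \<C> (pullback_riem N f M)"
    if "smooth_manifold N \<and> local_diffeo N M f" for N :: "('a, 'n) mfd" and f
  proof clarify
    fix u assume u: "u \<in> U_set \<C> M"
    have N: "smooth_manifold N" and f: "local_diffeo N M f"
      using that by auto
    have uC: "u \<in> C_inf M"
      using u by (simp add: U_set_def)
    have "opr C (pullback_riem N f M) (replicate (rank C - 1) (pullback N f u)) p > 0"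
      if C: "C \<in> \<C>" and p: "p \<in> pts N" for C p
    proof -
      have "replicate (rank C - 1) u \<in> tuples (C_inf M) (rank C - 1)"
        using uC by (auto simp: tuples_def)
      from polydiff_op_pullback[OF poly[OF C] N assms(2) f this p]
      have "opr C (pullback_riem N f M) (replicate (rank C - 1) (pullback N f u)) p =
          opr C M (replicate (rank C - 1) u) (f p)"
        by simp
      \<comment> \<open>The constraint is positive only at points of \<open>M\<close>, so
        \<open>f p\<close> has to be located in \<open>pts M\<close>.\<close>
      moreover obtain W where "p \<in> W" "diffeo_between N M W (f ` W) f (inv_into W f)"
        using local_diffeo_imp_diffeo_between[OF N sM f p] .
      then have "f p \<in> pts M"
        using openin_subset[OF diffeo_between.W'] by blast
      ultimately show ?thesis
        using u C by (simp add: U_set_def)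
    qed
    then show "pullback N f u \<in> U_set \<C> (pullback_riem N f M)"
      using C_inf_pullback[OF N sM f uC] by (simp add: U_set_def)
  qed
qed

end
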